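(* Let $(H,f)$ be a vertex-weighted graph where $H$ is connected with at least one edge and $f$ is not identically zero, and let $G=L(H,f)$. Then $k(G)=1$ if one of the following holds: (i) $f(u)=f(v)=1$ for some edge $uv$ of $H$; (ii) $f(v)\le 1$ for every vertex $v$ of $H$.
   Context: All graphs are finite and simple. For a digraph $D$, its competition graph $C(D)$ has vertex set $V(D)$, two distinct vertices $u,v$ adjacent iff some vertex $x$ satisfies $(u,x),(v,x)\in A(D)$. The competition number $k(G)$ is the smallest nonnegative integer $k$ such that $G$ together with $k$ new isolated vertices is the competition graph of an acyclic digraph. For a positive integer $m$, $CP(m)$ is the complete multipartite graph with $m$ parts each of size two ($CP(1)$ is two nonadjacent vertices). A vertex-weighted graph $(H,f)$ is a graph $H$ with $f:V(H)\to\mathbb{Z}_{\ge0}$. The generalized line graph $L(H,f)$ is obtained from the disjoint union of the line graph $L(H)$ (vertex set $E(H)$, two distinct edges adjacent iff they share an endpoint) and the graphs $Q_v:=CP(f(v))$ for each $v$ with $f(v)>0$, by adding all edges between every vertex of $Q_v$ and every $e\in E(H)$ incident to $v$. *)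

theory Defs
  imports Main
begin

text \<open>A finite simple graph is given by a vertex set V and a set E of 2-element
  subsets of V (the edges).\<close>
definition simple_graph :: "'a set \<Rightarrow> 'a set set \<Rightarrow> bool" where
  "simple_graph V E \<longleftrightarrow> finite V \<and>
     (\<forall>e\<in>E. \<exists>u v. u \<noteq> v \<and> u \<in> V \<and> v \<in> V \<and> e = {u, v})"

definition adj_rel :: "'a set set \<Rightarrow> ('a \<times> 'a) set" where
  "adj_rel E = {(u, v). {u, v} \<in> E}"

definition connected_graph :: "'a set \<Rightarrow> 'a set set \<Rightarrow> bool" where
  "connected_graph V E \<longleftrightarrow> V \<noteq> {} \<and> (\<forall>u\<in>V. \<forall>v\<in>V. (u, v) \<in> (adj_rel E)\<^sup>*)"

text \<open>Competition graph of a digraph with vertex set W and arc set A: its edge set.\<close>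
definition competition_edges :: "'b set \<Rightarrow> ('b \<times> 'b) set \<Rightarrow> 'b set set" where
  "competition_edges W A =
     {{u, v} | u v. u \<in> W \<and> v \<in> W \<and> u \<noteq> v \<and> (\<exists>x. (u, x) \<in> A \<and> (v, x) \<in> A)}"

text \<open>Competition number: the least k such that G together with k new isolated
  vertices (Inr 0, ..., Inr (k-1)) is the competition graph of an acyclic digraph.\<close>
definition competition_number :: "'a set \<Rightarrow> 'a set set \<Rightarrow> nat" where
  "competition_number V E = (LEAST k. \<exists>A :: (('a + nat) \<times> ('a + nat)) set.
     A \<subseteq> (Inl ` V \<union> Inr ` {..<k}) \<times> (Inl ` V \<union> Inr ` {..<k}) \<and> acyclic A \<and>
     competition_edges (Inl ` V \<union> Inr ` {..<k}) A = (\<lambda>e. Inl ` e) ` E)"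

text \<open>Generalized line graph L(H,f). Vertices: Inl e for edges e of H, and
  Inr (v,i,b) for v in V(H), i < f v, b :: bool, forming Q_v = CP(f v) whose parts are
  {(v,i,False),(v,i,True)}.\<close>
definition gl_vertices :: "'a set \<Rightarrow> 'a set set \<Rightarrow> ('a \<Rightarrow> nat) \<Rightarrow> ('a set + ('a \<times> nat \<times> bool)) set" where
  "gl_vertices V E f = Inl ` E \<union> Inr ` {(v, i, b). v \<in> V \<and> i < f v}"

definition gl_edges :: "'a set \<Rightarrow> 'a set set \<Rightarrow> ('a \<Rightarrow> nat) \<Rightarrow> ('a set + ('a \<times> nat \<times> bool)) set set" where
  "gl_edges V E f =
     {{Inl e, Inl e'} | e e'. e \<in> E \<and> e' \<in> E \<and> e \<noteq> e' \<and> e \<inter> e' \<noteq> {}}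
   \<union> {{Inr (v, i, b), Inr (v, j, c)} | v i j b c. v \<in> V \<and> i < f v \<and> j < f v \<and> i \<noteq> j}
   \<union> {{Inr (v, i, b), Inl e} | v i b e. v \<in> V \<and> i < f v \<and> e \<in> E \<and> v \<in> e}"

end

theory Submission
  imports Defs
begin

text \<open>
  Order the vertices of H as g 0, g 1, ... so that every later vertex has an earlier neighbour and
  f (g 0) = 1, and write x_j, y_j for the two vertices of the j-th part of Q_v. The edges of
  L(H,f) at v = g i are covered by the cliques consisting of all edges of H at v together with
  all x_j, with all y_j, or (needed only if f v \<ge> 2) with one x_j and all y_k, k \<noteq> j.
  Rank the vertices of L(H,f) by blocks, block i consisting of first the x_j, then the y_j of g i,
  then the edges of H whose last endpoint is g i. Every clique needs its own prey of smaller rank: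
  the clique of all x_j takes an edge of the preceding block (the new isolated vertex for i = 0,
  and a y of g 0 for i = 1), and the others take the x_j in turn. If f v \<ge> 2 one prey is missing,
  and a y of the last earlier vertex of positive weight is still free: that vertex is not g 0, as
  weights \<ge> 2 occur only under (i), where g 0 and g 1 are chosen as the given edge. Conversely, a sink of an acyclic digraph is isolated in its competition graph.
\<close>

section \<open>Competition number one from a clique cover with distinct prey\<close>

text \<open>Let every member of \<open>K c\<close> prey on \<open>prey c\<close>, where
  \<open>None\<close> is the one new isolated vertex. Distinct cliques have distinct prey, so two
  vertices compete exactly when some clique contains both. Every arc descends in the well-founded
  \<open>r\<close>, which excludes cycles.\<close>

lemma competition_number_eq_1:
  fixes V :: "'b set" and K :: "'i \<Rightarrow> 'b set" and prey :: "'i \<Rightarrow> 'b option"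
  assumes fin: "finite V" and ne: "V \<noteq> {}"
    and no_isolated: "\<And>w. w \<in> V \<Longrightarrow> \<exists>e\<in>E. w \<in> e"
    and edge: "\<And>e. e \<in> E \<Longrightarrow> \<exists>u v. u \<noteq> v \<and> e = {u, v}"
    and K_sub: "\<And>c. c \<in> I \<Longrightarrow> K c \<subseteq> V"
    and clique: "\<And>c u v. c \<in> I \<Longrightarrow> u \<in> K c \<Longrightarrow> v \<in> K c \<Longrightarrow> u \<noteq> v \<Longrightarrow> {u, v} \<in> E"
    and cover: "\<And>e. e \<in> E \<Longrightarrow> \<exists>c\<in>I. e \<subseteq> K c"
    and inj: "inj_on prey I"
    and prey: "\<And>c w. c \<in> I \<Longrightarrow> prey c = Some w \<Longrightarrow> w \<in> V"
    and wf: "wf r"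
    and decreasing: "\<And>c w. c \<in> I \<Longrightarrow> w \<in> K c \<Longrightarrow> (prey c, Some w) \<in> r"
  shows "competition_number V E = 1"
  unfolding competition_number_def
proof (rule Least_equality, goal_cases)
  case 1
  define h :: "'b option \<Rightarrow> 'b + nat" where "h = case_option (Inr 0) Inl"
  \<comment> \<open>A left inverse of \<open>h\<close>; through it \<open>r\<close> is pulled back
    to the vertices of the digraph.\<close>
  define h' :: "'b + nat \<Rightarrow> 'b option" where "h' = case_sum Some (\<lambda>_. None)"
  define A :: "(('b + nat) \<times> ('b + nat)) set" where
    "A = {(Inl w, h (prey c)) | w c. c \<in> I \<and> w \<in> K c}"
  let ?W = "Inl ` V \<union> Inr ` {..<1} :: ('b + nat) set"
  have hh: "h' (h z) = z" for z
    by (cases z) (simp_all add: h_def h'_def)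
  have h_inj: "h z = h z' \<Longrightarrow> z = z'" for z z'
    using hh by metis
  have "h (prey c) \<in> ?W" if "c \<in> I" for c
    using prey[OF that] by (cases "prey c") (auto simp: h_def)
  then have sub: "A \<subseteq> ?W \<times> ?W"
    using K_sub unfolding A_def by blast
  have "A\<inverse> \<subseteq> inv_image r h'"
    using decreasing hh by (auto simp: A_def inv_image_def h'_def)
  then have "acyclic (A\<inverse>)"
    using wf wf_inv_image wf_subset wf_acyclic by blast
  then have acyc: "acyclic A"
    by (simp add: acyclic_converse)
  have "competition_edges ?W A = (\<lambda>e. Inl ` e) ` E"
  proof (intro equalityI subsetI)
    fix d assume "d \<in> competition_edges ?W A"
    then obtain u v x where d: "d = {u, v}" "u \<noteq> v" "(u, x) \<in> A" "(v, x) \<in> A"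
      unfolding competition_edges_def by blast
    then obtain u' v' c c' where "u = Inl u'" "v = Inl v'" "x = h (prey c)" "x = h (prey c')"
      "c \<in> I" "c' \<in> I" "u' \<in> K c" "v' \<in> K c'"
      unfolding A_def by blast
    moreover from this have "c = c'"
      using h_inj inj by (metis inj_onD)
    ultimately show "d \<in> (\<lambda>e. Inl ` e) ` E"
      using d clique[of c u' v'] by (intro image_eqI[of _ _ "{u', v'}"]) auto
  next
    fix d :: "('b + nat) set" assume "d \<in> (\<lambda>e. Inl ` e) ` E"
    then obtain e where e: "e \<in> E" "d = Inl ` e" by blast
    obtain u v where uv: "u \<noteq> v" "e = {u, v}" using edge[OF e(1)] by blast
    obtain c where c: "c \<in> I" "e \<subseteq> K c" using cover[OF e(1)] by blast
    have "(Inl u, h (prey c)) \<in> A" "(Inl v, h (prey c)) \<in> A" "u \<in> V" "v \<in> V"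
      using c uv K_sub[OF c(1)] unfolding A_def by auto
    then show "d \<in> competition_edges ?W A"
      unfolding competition_edges_def mem_Collect_eq using uv e(2)
      by (intro exI[of _ "Inl u"] exI[of _ "Inl v"]) auto
  qed
  with sub acyc show ?case by blast
next
  case (2 k)
  then obtain A :: "(('b + nat) \<times> ('b + nat)) set" where A:
    "A \<subseteq> (Inl ` V \<union> Inr ` {..<k}) \<times> (Inl ` V \<union> Inr ` {..<k})" "acyclic A"
    "competition_edges (Inl ` V \<union> Inr ` {..<k}) A = (\<lambda>e. Inl ` e) ` E"
    by blast
  show ?case
  proof (rule ccontr)
    assume "\<not> 1 \<le> k"
    then have k: "k = 0" by simp
    have "finite A"
      by (rule finite_subset[OF A(1)]) (use fin in auto)
    \<comment> \<open>For \<open>k = 0\<close> every arc ends at a copy of a vertex in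
      \<open>V\<close>, so a minimal element of the converse relation has no prey at all.\<close>
    then have "wf (A\<inverse>)"
      using A(2) by (rule finite_acyclic_wf_converse)
    moreover have "Inl ` V \<noteq> ({} :: ('b + nat) set)" using ne by blast
    ultimately obtain s :: "'b + nat" where
      s: "s \<in> Inl ` V" "\<And>y. (y, s) \<in> A\<inverse> \<Longrightarrow> y \<notin> Inl ` V"
      by (metis wfE_min')
    then have sink: "(s, y) \<notin> A" for y
      using A(1) k by auto
    obtain w where w: "w \<in> V" "s = Inl w" using s(1) by blast
    obtain e where "e \<in> E" "w \<in> e" using no_isolated[OF w(1)] by blast
    then have "Inl ` e \<in> competition_edges (Inl ` V \<union> Inr ` {..<k}) A" "s \<in> Inl ` e"
      using A(3) w(2) by auto
    then show False
      using sink unfolding competition_edges_def mem_Collect_eq by (metis empty_iff insert_iff)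
  qed
qed

section \<open>Vertex orderings of a connected graph\<close>

text \<open>A walk from \<open>u\<close> to \<open>v\<close> has to cross the boundary of
  \<open>S\<close>; induction along the walk finds the crossing.\<close>

lemma connected_leaving_edge:
  assumes "connected_graph V E" "u \<in> S" "v \<in> V - S" "S \<subseteq> V"
  obtains x y where "x \<in> S" "y \<notin> S" "{x, y} \<in> E"
proof -
  have "(u, v) \<in> (adj_rel E)\<^sup>*"
    using assms unfolding connected_graph_def by blast
  then have "v \<notin> S \<Longrightarrow> \<exists>x y. x \<in> S \<and> y \<notin> S \<and> {x, y} \<in> E"
    using assms(2) by induction (auto simp: adj_rel_def)
  then show thesis using assms(3) that by blast
qed

text \<open>While a vertex is missing, some edge leaves the listed vertices, and its outer end can
  be appended. The induction is on the number of missing vertices.\<close>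

lemma connected_list_extension:
  assumes "simple_graph V E" "connected_graph V E" "distinct vs" "set vs \<subseteq> V" "vs \<noteq> []"
    and "\<And>i. 0 < i \<Longrightarrow> i < length vs \<Longrightarrow> \<exists>j<i. {vs ! j, vs ! i} \<in> E"
  shows "\<exists>ws. distinct (vs @ ws) \<and> set (vs @ ws) = V \<and>
    (\<forall>i. 0 < i \<longrightarrow> i < length (vs @ ws) \<longrightarrow> (\<exists>j<i. {(vs @ ws) ! j, (vs @ ws) ! i} \<in> E))"
  using assms(3-)
proof (induction "card (V - set vs)" arbitrary: vs)
  case 0
  have "finite V" using assms(1) unfolding simple_graph_def by blast
  with 0 have "set vs = V" by auto
  with 0 show ?case by (intro exI[of _ "[]"]) auto
next
  case (Suc m)
  have "finite V" using assms(1) unfolding simple_graph_def by blast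
  have "V - set vs \<noteq> {}" using Suc(2) by (metis card.empty nat.distinct(1))
  then obtain v where "v \<in> V - set vs" by blast
  moreover have "hd vs \<in> set vs" using Suc by simp
  ultimately obtain x y where xy: "x \<in> set vs" "y \<notin> set vs" "{x, y} \<in> E"
    using connected_leaving_edge[OF assms(2)] Suc.prems(2) by metis
  have "y \<in> V"
    using assms(1) xy(3) unfolding simple_graph_def by (metis insertCI insertE singletonD)
  obtain k where k: "k < length vs" "vs ! k = x" using xy(1) by (metis in_set_conv_nth)
  have "V - set (vs @ [y]) = (V - set vs) - {y}" by auto
  then have "m = card (V - set (vs @ [y]))"
    using Suc(2) \<open>y \<in> V\<close> xy(2) \<open>finite V\<close> by simp
  moreover have "\<exists>j<i. {(vs @ [y]) ! j, (vs @ [y]) ! i} \<in> E"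
    if i: "0 < i" "i < length (vs @ [y])" for i
  proof (cases "i < length vs")
    case True
    then show ?thesis using Suc.prems(4)[OF i(1)] by (auto simp: nth_append intro: order.strict_trans)
  next
    case False
    then have "i = length vs" using i by simp
    then show ?thesis using k xy(3) by (auto simp: nth_append)
  qed
  moreover have "distinct (vs @ [y])" "set (vs @ [y]) \<subseteq> V" "vs @ [y] \<noteq> []"
    using Suc.prems xy(2) \<open>y \<in> V\<close> by auto
  ultimately obtain ws where "distinct ((vs @ [y]) @ ws) \<and> set ((vs @ [y]) @ ws) = V \<and>
    (\<forall>i. 0 < i \<longrightarrow> i < length ((vs @ [y]) @ ws) \<longrightarrow>
      (\<exists>j<i. {((vs @ [y]) @ ws) ! j, ((vs @ [y]) @ ws) ! i} \<in> E))"
    using Suc(1)[of "vs @ [y]"] by blast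
  then show ?case by (intro exI[of _ "y # ws"]) simp
qed

text \<open>Extending the list \<open>[u, v]\<close> puts the given edge at positions 0 and
  1.\<close>

lemma connected_enumeration:
  assumes graph: "simple_graph V E" and conn: "connected_graph V E"
    and uv: "{u, v} \<in> E" "u \<noteq> v"
  obtains g and n :: nat where "bij_betw g {..<n} V" "2 \<le> n" "g 0 = u" "g 1 = v"
    "\<And>i. 0 < i \<Longrightarrow> i < n \<Longrightarrow> \<exists>j<i. {g j, g i} \<in> E"
proof -
  obtain a b where "{u, v} = {a, b}" "a \<in> V" "b \<in> V"
    using graph uv(1) unfolding simple_graph_def by meson
  then have "{u, v} \<subseteq> V" by simp
  have "\<exists>j<i. {[u, v] ! j, [u, v] ! i} \<in> E" if "0 < i" "i < length [u, v]" for i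
    using that uv by (intro exI[of _ 0]) (auto simp: less_Suc_eq)
  moreover have "distinct [u, v]" "set [u, v] \<subseteq> V" "[u, v] \<noteq> []"
    using uv(2) \<open>{u, v} \<subseteq> V\<close> by auto
  ultimately obtain ws where ws: "distinct ([u, v] @ ws)" "set ([u, v] @ ws) = V"
    "\<And>i. 0 < i \<Longrightarrow> i < length ([u, v] @ ws) \<Longrightarrow>
      \<exists>j<i. {([u, v] @ ws) ! j, ([u, v] @ ws) ! i} \<in> E"
    using connected_list_extension[OF graph conn, of "[u, v]"] by blast
  show thesis
  proof (rule that[of "(!) ([u, v] @ ws)" "length ([u, v] @ ws)"])
    show "bij_betw ((!) ([u, v] @ ws)) {..<length ([u, v] @ ws)} V"
      using ws(1,2) by (intro bij_betw_nth) auto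
    show "\<exists>j<i. {([u, v] @ ws) ! j, ([u, v] @ ws) ! i} \<in> E"
      if "0 < i" "i < length ([u, v] @ ws)" for i
      by (rule ws(3)[OF that])
  qed simp_all
qed

section \<open>The three kinds of edges of a generalized line graph\<close>

lemma gl_edges_LL:
  "d \<in> E \<Longrightarrow> d' \<in> E \<Longrightarrow> d \<noteq> d' \<Longrightarrow> w \<in> d \<Longrightarrow> w \<in> d' \<Longrightarrow> {Inl d, Inl d'} \<in> gl_edges V E f"
  unfolding gl_edges_def by (intro UnI1 CollectI exI[of _ d] exI[of _ d']) auto

lemma gl_edges_QQ:
  "w \<in> V \<Longrightarrow> i < f w \<Longrightarrow> j < f w \<Longrightarrow> i \<noteq> j \<Longrightarrow> {Inr (w, i, b), Inr (w, j, c)} \<in> gl_edges V E f"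
  unfolding gl_edges_def by (rule UnI1, rule UnI2, rule CollectI, intro exI conjI, rule refl)

lemma gl_edges_QL:
  "w \<in> V \<Longrightarrow> i < f w \<Longrightarrow> d \<in> E \<Longrightarrow> w \<in> d \<Longrightarrow> {Inr (w, i, b), Inl d} \<in> gl_edges V E f"
  unfolding gl_edges_def by (rule UnI2, rule CollectI, intro exI conjI, rule refl)

lemma gl_edges_cases:
  assumes "d \<in> gl_edges V E f"
  obtains (LL) d1 d2 where "d = {Inl d1, Inl d2}" "d1 \<in> E" "d2 \<in> E" "d1 \<noteq> d2" "d1 \<inter> d2 \<noteq> {}"
    | (QQ) w i j b c where "d = {Inr (w, i, b), Inr (w, j, c)}" "w \<in> V" "i < f w" "j < f w" "i \<noteq> j"
    | (QL) w i b d1 where "d = {Inr (w, i, b), Inl d1}" "w \<in> V" "i < f w" "d1 \<in> E" "w \<in> d1"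
  using assms unfolding gl_edges_def by (elim UnE CollectE exE conjE) (rule that; assumption)+

section \<open>The clique cover of a generalized line graph and its prey\<close>

text \<open>This form unites the two cases: in (i) both ends of the edge have weight 1, in (ii)
  \<open>u\<close> has weight 1 and \<open>v\<close> is any neighbour.\<close>

lemma generalized_line_graph_competition_number:
  fixes V :: "'a set" and E :: "'a set set" and f :: "'a \<Rightarrow> nat"
  assumes graph: "simple_graph V E" and conn: "connected_graph V E"
    and uv: "{u, v} \<in> E" "u \<noteq> v" and fu: "f u = 1"
    and fv: "f v = 1 \<or> (\<forall>v\<in>V. f v \<le> 1)"
  shows "competition_number (gl_vertices V E f) (gl_edges V E f) = 1"
proof -
  obtain g and n :: nat where g: "bij_betw g {..<n} V" "2 \<le> n" "g 0 = u" "g 1 = v"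
    and earlier: "\<And>i. 0 < i \<Longrightarrow> i < n \<Longrightarrow> \<exists>j<i. {g j, g i} \<in> E"
    using connected_enumeration[OF graph conn uv] by metis
  have g_inj: "g i = g j \<longleftrightarrow> i = j" if "i < n" "j < n" for i j
    using g(1) that by (auto simp: bij_betw_def inj_on_def)
  have g_V: "g i \<in> V" if "i < n" for i
    using g(1) that by (auto simp: bij_betw_def)
  have g_surj: "\<exists>i<n. g i = w" if "w \<in> V" for w
    using g(1) that by (auto simp: bij_betw_def)
  have finV: "finite V" and edge_H: "\<And>e. e \<in> E \<Longrightarrow> \<exists>u v. u \<noteq> v \<and> u \<in> V \<and> v \<in> V \<and> e = {u, v}"
    using graph unfolding simple_graph_def by auto
  define idx where "idx w = (THE i. i < n \<and> g i = w)" for w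
  have idx: "idx (g i) = i" if "i < n" for i
    unfolding idx_def using g_inj that by (intro the_equality) auto
  define last where "last e = Max (idx ` e)" for e
  have last_ge: "i \<le> last e" if "e \<in> E" "g i \<in> e" "i < n" for e i
  proof -
    have "finite e" using edge_H[OF that(1)] by auto
    then show ?thesis unfolding last_def using idx[OF that(3)] that(2) by (intro Max_ge) force+
  qed
  \<comment> \<open>The edge to an earlier neighbour of \<open>g i\<close> ends in block i. Block 0
    contains no edge of H, hence the restriction to positive i.\<close>
  have "\<exists>e\<in>E. last e = i" if i: "0 < i" "i < n" for i
  proof -
    obtain j where j: "j < i" "{g j, g i} \<in> E" using earlier[OF i] by blast
    then show ?thesis
      using i idx by (intro bexI[of _ "{g j, g i}"]) (auto simp: last_def)
  qed
  then obtain e where e: "e i \<in> E" "last (e i) = i" if "0 < i" "i < n" for i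
    by metis
  define heavy where "heavy = {i. i < n \<and> 2 \<le> f (g i)}"
  define q where "q i = Max {l. l < i \<and> 1 \<le> f (g l)}" for i
  have q: "1 \<le> q i \<and> q i < i \<and> 1 \<le> f (g (q i))" and q_max: "\<And>l. l < i \<Longrightarrow> 1 \<le> f (g l) \<Longrightarrow> l \<le> q i"
    if i: "i \<in> heavy" for i
  proof -
    have "\<not> f (g i) \<le> 1" "i < n" using i unfolding heavy_def by auto
    then have "f v = 1" using fv g_V by blast
    \<comment> \<open>Both \<open>g 0\<close> and \<open>g 1\<close> have weight 1 here, so position
      1 is a candidate for \<open>q i\<close>.\<close>
    then have "i \<noteq> 0" "i \<noteq> 1"
      using fu g(3,4) \<open>\<not> f (g i) \<le> 1\<close> by (metis order_refl)+
    then have "1 \<in> {l. l < i \<and> 1 \<le> f (g l)}"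
      using \<open>f v = 1\<close> g(4) by auto
    moreover have fin: "finite {l. l < i \<and> 1 \<le> f (g l)}" by simp
    ultimately have "q i \<in> {l. l < i \<and> 1 \<le> f (g l)}" "1 \<le> q i"
      unfolding q_def using Max_in Max_ge by blast+
    then show "1 \<le> q i \<and> q i < i \<and> 1 \<le> f (g (q i))" by blast
    show "l \<le> q i" if "l < i" "1 \<le> f (g l)" for l
      unfolding q_def using that fin by (intro Max_ge) auto
  qed
  have q_inj: "i = i'" if "i \<in> heavy" "i' \<in> heavy" "q i = q i'" for i i'
  \<comment> \<open>The earlier of two heavy positions has positive weight, so \<open>q\<close> of
    the later one is at least that position, which exceeds its own \<open>q\<close>.\<close>
  proof (rule ccontr)
    assume "i \<noteq> i'"
    moreover have "1 \<le> f (g i)" "1 \<le> f (g i')" using that by (auto simp: heavy_def)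
    ultimately show False
      using that q[of i] q[of i'] q_max[of i i'] q_max[of i' i] by linarith
  qed
  \<comment> \<open>For weight 1 the index 1 would describe the same clique as 0 and is left out;
    for weight 0 only 0 remains.\<close>
  define I where "I = {(i, k). i < n \<and> (k = 0 \<or> k = 1 \<and> i \<in> heavy \<or> 2 \<le> k \<and> k \<le> Suc (f (g i)))}"
  \<comment> \<open>x_j is encoded by False and y_j by True; k = 0 gives all x_j, k = f (g i) + 1 all y_j.\<close>
  define K where "K = (\<lambda>(i, k). Inl ` {d \<in> E. g i \<in> d} \<union>
    Inr ` {(w, j, b). w = g i \<and> j < f w \<and> b = (k \<noteq> 0 \<and> k \<noteq> Suc j)})"
  \<comment> \<open>For k \<ge> 2 the only x that clique k can contain is x_(k-1), so x_(k-2) still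
    ranks below all its members. Position 1 cannot use an edge of block 0, as there is none.\<close>
  define prey :: "nat \<times> nat \<Rightarrow> ('a set + 'a \<times> nat \<times> bool) option" where
    "prey = (\<lambda>(i, k).
    if k = 0 then (if i = 0 then None else if i = 1 then Some (Inr (g 0, 0, True))
                   else Some (Inl (e (i - 1))))
    else if k = 1 then Some (Inr (g (q i), 0, True))
    else Some (Inr (g i, k - 2, False)))"
  \<comment> \<open>Lexicographic: block number plus one, then 0 for x, 1 for y, 2 for edges of H,
    then the index among the x_j. The isolated vertex comes before all blocks.\<close>
  define rank :: "('a set + 'a \<times> nat \<times> bool) option \<Rightarrow> nat \<times> nat \<times> nat" where
    "rank z = (case z of None \<Rightarrow> (0, 0, 0)
      | Some (Inl d) \<Rightarrow> (Suc (last d), 2, 0)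
      | Some (Inr (w, j, b)) \<Rightarrow> (Suc (idx w), if b then (1, 0) else (0, j)))" for z
  have no_isolated_H: "\<exists>d\<in>E. w \<in> d" if w: "w \<in> V" for w
  proof -
    obtain i where i: "i < n" "w = g i" using g_surj[OF w] by blast
    show ?thesis
      using earlier[of i] i uv g(3) by (cases "i = 0") auto
  qed
  show ?thesis
  proof (rule competition_number_eq_1[where I = I and K = K and prey = prey
        and r = "inv_image (less_than <*lex*> less_than <*lex*> less_than) rank"])
    have "E \<subseteq> Pow V" using edge_H by blast
    then have "finite E" using finV by (simp add: finite_subset)
    moreover have "{(w, i, b). w \<in> V \<and> i < f w} \<subseteq> (SIGMA w:V. {..<f w} \<times> (UNIV :: bool set))"
      by auto
    then have "finite {(w, i, b :: bool). w \<in> V \<and> i < f w}"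
      by (rule finite_subset) (use finV in auto)
    ultimately show "finite (gl_vertices V E f)"
      unfolding gl_vertices_def by simp
  next
    show "gl_vertices V E f \<noteq> {}"
      using uv unfolding gl_vertices_def by auto
  next
    fix x assume "x \<in> gl_vertices V E f"
    then consider (edge) d where "x = Inl d" "d \<in> E"
      | (Q) w i b where "x = Inr (w, i, b)" "w \<in> V" "i < f w"
      unfolding gl_vertices_def by blast
    then show "\<exists>d\<in>gl_edges V E f. x \<in> d"
    proof cases
      case (edge d)
      show ?thesis
      proof (cases "u \<in> d")
        case True
        moreover have "u \<in> V" using g_V[of 0] g(2,3) by simp
        ultimately have "{Inr (u, 0, True), Inl d} \<in> gl_edges V E f"
          using edge fu by (intro gl_edges_QL) auto
        then show ?thesis using edge by blast
      next
        \<comment> \<open>The set \<open>d\<close> misses \<open>u\<close>, so an edge of H leaves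
          it; that edge shares one endpoint with \<open>d\<close> and differs from it.\<close>
        case False
        obtain a where "a \<in> d" "d \<subseteq> V" using edge_H[OF edge(2)] by auto
        moreover have "u \<in> V" using g_V[of 0] g(2,3) by simp
        ultimately obtain x' y' where xy: "x' \<in> d" "y' \<notin> d" "{x', y'} \<in> E"
          using connected_leaving_edge[OF conn, of a d u] False by auto
        then have "{Inl d, Inl {x', y'}} \<in> gl_edges V E f"
          using edge(2) by (intro gl_edges_LL) auto
        then show ?thesis using edge(1) by blast
      qed
    next
      case (Q w i b)
      then obtain d where "d \<in> E" "w \<in> d" using no_isolated_H by blast
      then have "{Inr (w, i, b), Inl d} \<in> gl_edges V E f"
        using Q by (intro gl_edges_QL)
      then show ?thesis using Q by blast
    qed
  next
    fix d assume "d \<in> gl_edges V E f"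
    then show "\<exists>x y. x \<noteq> y \<and> d = {x, y}"
    proof (cases rule: gl_edges_cases)
      case (LL d1 d2)
      then show ?thesis by (intro exI[of _ "Inl d1"] exI[of _ "Inl d2"]) simp
    next
      case (QQ w i j b c)
      then show ?thesis by (intro exI[of _ "Inr (w, i, b)"] exI[of _ "Inr (w, j, c)"]) simp
    next
      case (QL w i b d1)
      then show ?thesis by (intro exI[of _ "Inr (w, i, b)"] exI[of _ "Inl d1"]) simp
    qed
  next
    fix c assume "c \<in> I"
    then show "K c \<subseteq> gl_vertices V E f"
      using g_V by (auto simp: I_def K_def gl_vertices_def)
  next
    fix c x y assume "c \<in> I" "x \<in> K c" "y \<in> K c" "x \<noteq> y"
    moreover obtain i k where c: "c = (i, k)" by force
    ultimately have "g i \<in> V" and x: "x \<in> K (i, k)" and y: "y \<in> K (i, k)"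
      using g_V by (auto simp: I_def)
    have K_cases: "(\<exists>d. z = Inl d \<and> d \<in> E \<and> g i \<in> d) \<or>
        (\<exists>j. z = Inr (g i, j, k \<noteq> 0 \<and> k \<noteq> Suc j) \<and> j < f (g i))" if "z \<in> K (i, k)" for z
      using that by (auto simp: K_def)
    from K_cases[OF x] K_cases[OF y] show "{x, y} \<in> gl_edges V E f"
    proof (elim disjE exE conjE)
      fix d d' assume "x = Inl d" "d \<in> E" "g i \<in> d" "y = Inl d'" "d' \<in> E" "g i \<in> d'"
      then show ?thesis using \<open>x \<noteq> y\<close> gl_edges_LL[of d E d' "g i"] by simp
    next
      fix d j assume "x = Inl d" "d \<in> E" "g i \<in> d"
        "y = Inr (g i, j, k \<noteq> 0 \<and> k \<noteq> Suc j)" "j < f (g i)"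
      then show ?thesis
        using gl_edges_QL[OF \<open>g i \<in> V\<close>] by (simp add: insert_commute)
    next
      fix d j assume "y = Inl d" "d \<in> E" "g i \<in> d"
        "x = Inr (g i, j, k \<noteq> 0 \<and> k \<noteq> Suc j)" "j < f (g i)"
      then show ?thesis
        using gl_edges_QL[OF \<open>g i \<in> V\<close>] by simp
    next
      \<comment> \<open>Within a clique, j determines which of x_j and y_j occurs, so distinct
        members lie in different parts of Q_v.\<close>
      fix j j' assume "x = Inr (g i, j, k \<noteq> 0 \<and> k \<noteq> Suc j)" "j < f (g i)"
        "y = Inr (g i, j', k \<noteq> 0 \<and> k \<noteq> Suc j')" "j' < f (g i)"
      then show ?thesis
        using \<open>x \<noteq> y\<close> gl_edges_QQ[OF \<open>g i \<in> V\<close>, of j f j'] by (cases "j = j'") auto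
    qed
  next
    fix d assume "d \<in> gl_edges V E f"
    then show "\<exists>c\<in>I. d \<subseteq> K c"
    proof (cases rule: gl_edges_cases)
      case (LL d1 d2)
      then obtain w where "w \<in> d1" "w \<in> d2" by blast
      moreover from this obtain l where "l < n" "g l = w"
        using edge_H[OF LL(2)] g_surj by blast
      ultimately show ?thesis
        using LL by (intro bexI[of _ "(l, 0)"]) (auto simp: K_def I_def)
    next
      case (QQ w i j b c)
      then obtain l where l: "l < n" "g l = w" using g_surj by blast
      then have "l \<in> heavy" using QQ by (auto simp: heavy_def)
      \<comment> \<open>Two x need 0 and two y need the last index; a mixed pair needs the clique
        with just that x. The value 1 can arise, which is why \<open>l\<close> has to be
        heavy.\<close>
      define k where "k = (if b then if c then Suc (f w) else Suc j else if c then Suc i else 0)"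
      have "k \<le> Suc (f w)" using QQ by (auto simp: k_def)
      then have "(l, k) \<in> I" using l \<open>l \<in> heavy\<close> by (auto simp: I_def)
      moreover have "d \<subseteq> K (l, k)" using QQ l by (auto simp: K_def k_def)
      ultimately show ?thesis by blast
    next
      case (QL w i b d1)
      then obtain l where l: "l < n" "g l = w" using g_surj by blast
      define k where "k = (if b then Suc (f w) else 0)"
      have "(l, k) \<in> I" using l QL by (auto simp: I_def k_def)
      moreover have "d \<subseteq> K (l, k)" using QL l by (auto simp: K_def k_def)
      ultimately show ?thesis by blast
    qed
  next
    have e_inj: "i = i'"
      if "e (i - 1) = e (i' - 1)" "i \<noteq> 0" "i \<noteq> 1" "i' \<noteq> 0" "i' \<noteq> 1" "i < n" "i' < n" for i i'
    proof -
      have "0 < i - 1" "i - 1 < n" "0 < i' - 1" "i' - 1 < n" using that by linarith+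
      \<comment> \<open>Applying \<open>last\<close> to the chosen edges recovers their
        blocks.\<close>
      then have "i - 1 = i' - 1" using e(2) that(1) by metis
      then show ?thesis using that by linarith
    qed
    \<comment> \<open>This keeps the prey for k = 1 apart from the y of \<open>g 0\<close> that
      serves position 1.\<close>
    have q_ne: "g (q i) \<noteq> g 0" if "i \<in> heavy" for i
      using that q[of i] g_inj[of "q i" 0] by (simp add: heavy_def)
    have gq_inj: "i = i'" if "g (q i) = g (q i')" "i \<in> heavy" "i' \<in> heavy" for i i'
      using that q[of i] q[of i'] q_inj[of i i'] g_inj[of "q i" "q i'"] by (simp add: heavy_def)
    show "inj_on prey I"
    proof (rule inj_onI, clarify)
      fix i k i' k' assume I: "(i, k) \<in> I" "(i', k') \<in> I" and eq: "prey (i, k) = prey (i', k')"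
      consider "k = 0" | "k = 1" "i \<in> heavy" | "2 \<le> k" using I(1) by (auto simp: I_def)
      then show "i = i' \<and> k = k'"
      proof cases
        case 1
        then have "k' = 0"
          using I eq q_ne[of i'] by (auto simp: prey_def I_def split: if_splits)
        with 1 show ?thesis
          using I eq e_inj[of i i'] by (auto simp: prey_def I_def split: if_splits)
      next
        case 2
        then have "k' = 1"
          using I eq q_ne[of i] by (auto simp: prey_def split: if_splits)
        with 2 show ?thesis
          using I eq gq_inj[of i i'] by (auto simp: prey_def I_def)
      next
        case 3
        then have "2 \<le> k'" "g i = g i'" "k - 2 = k' - 2"
          using eq by (auto simp: prey_def split: if_splits)
        with 3 show ?thesis
          using I g_inj[of i i'] by (auto simp: I_def)
      qed
    qed
  next
    fix c x assume "c \<in> I" "prey c = Some x"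
    moreover obtain i k where c: "c = (i, k)" by force
    ultimately show "x \<in> gl_vertices V E f"
      using e(1)[of "i - 1"] g_V q[of i] fu g(2,3)
      by (auto simp: I_def prey_def gl_vertices_def heavy_def split: if_splits)
  next
    show "wf (inv_image (less_than <*lex*> less_than <*lex*> less_than) rank)"
      by (intro wf_inv_image wf_lex_prod wf_less_than)
  next
    fix c x assume "c \<in> I" "x \<in> K c"
    moreover obtain i k where c: "c = (i, k)" by force
    ultimately have ik: "i < n" "k = 1 \<Longrightarrow> i \<in> heavy" and x: "x \<in> K (i, k)"
      by (auto simp: I_def)
    have q_idx: "k = 1 \<Longrightarrow> idx (g (q i)) < i"
      using ik q[of i] idx[of "q i"] by simp
    have idx0: "idx (g 0) = 0" using idx[of 0] g(2) by simp
    from x consider (L) d where "x = Inl d" "d \<in> E" "g i \<in> d"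
      | (Q) j where "x = Inr (g i, j, k \<noteq> 0 \<and> k \<noteq> Suc j)"
      by (auto simp: K_def)
    then show "(prey c, Some x) \<in> inv_image (less_than <*lex*> less_than <*lex*> less_than) rank"
    proof cases
      \<comment> \<open>An edge at \<open>g i\<close> lies in block i or later, behind every x of
        block i; the prey for k = 0 and k = 1 come before block i.\<close>
      case (L d)
      then show ?thesis
        using last_ge[of d i] ik q_idx idx0 idx[of i] e(2)[of "i - 1"]
        by (auto simp: c prey_def rank_def)
    next
      case (Q j)
      then show ?thesis
        using ik q_idx idx0 idx[of i] e(2)[of "i - 1"]
        by (auto simp: c prey_def rank_def)
    qed
  qed
qed

section \<open>Reduction of the two cases to a suitable edge\<close>

theorem theorem2p11:
  fixes V :: "'a set" and E :: "'a set set" and f :: "'a \<Rightarrow> nat"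
  assumes "simple_graph V E"
    and "connected_graph V E"
    and "E \<noteq> {}"
    and "\<exists>v\<in>V. f v \<noteq> 0"
    and "(\<exists>u v. {u, v} \<in> E \<and> u \<noteq> v \<and> f u = 1 \<and> f v = 1) \<or> (\<forall>v\<in>V. f v \<le> 1)"
  shows "competition_number (gl_vertices V E f) (gl_edges V E f) = 1"
proof (cases "\<exists>u v. {u, v} \<in> E \<and> u \<noteq> v \<and> f u = 1 \<and> f v = 1")
  case True
  then show ?thesis
    using generalized_line_graph_competition_number[OF assms(1,2)] by blast
next
  case False
  then have le: "\<forall>v\<in>V. f v \<le> 1" using assms(5) by blast
  obtain u where u: "u \<in> V" "f u \<noteq> 0" using assms(4) by blast
  then have fu: "f u = 1" using le by (metis le_neq_implies_less less_one)
  \<comment> \<open>An edge provides a second vertex, so connectedness gives \<open>u\<close> a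
    neighbour.\<close>
  obtain a b where "a \<in> V" "b \<in> V" "a \<noteq> b"
    using assms(1,3) unfolding simple_graph_def by blast
  then obtain w where "w \<in> V - {u}" by blast
  then obtain v where "v \<noteq> u" "{u, v} \<in> E"
    using connected_leaving_edge[OF assms(2), of u "{u}"] u(1) by auto
  then show ?thesis
    using generalized_line_graph_competition_number[OF assms(1,2), of u v f] fu le by metis
qed

end
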